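(* Let $H=\langle a,b,c\rangle$ be a proportionally modular numerical semigroup minimally generated by three elements $a,b,c$, which is not symmetric, with generators arranged so that $\gcd(a,b)=\gcd(b,c)=1$ and $db=a+c$ for some integer $d\ge 2$. Let $k$ be a field, and let $\beta,\gamma,\alpha',\beta'$ be the positive integers such that the kernel of the $k$-algebra homomorphism $\varphi:k[X,Y,Z]\to k[t^a,t^b,t^c]$, $\varphi(X)=t^a$, $\varphi(Y)=t^b$, $\varphi(Z)=t^c$, is generated by the $2\times 2$ minors of the matrix $$\begin{pmatrix} X & Y^{\beta} & Z^{\gamma}\\ Y^{\beta'} & Z & X^{\alpha'}\end{pmatrix}.$$ Then the following conditions are equivalent: (1) $H$ is pseudo-symmetric; (2) $\beta\gamma=1$ or $\alpha'\beta'=1$; (3) $d=\frac{a+1}{2}$ or $d=\frac{c+1}{2}$.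
   Context: A numerical semigroup is a subset $H\subseteq\mathbb{N}=\{0,1,2,\dots\}$ containing $0$, closed under addition, with $\mathbb{N}\setminus H$ finite. $\mathrm{g}(H)=|\mathbb{N}\setminus H|$ and $\mathrm{F}(H)$ is the largest integer not in $H$. $H$ is symmetric if $2\mathrm{g}(H)=\mathrm{F}(H)+1$ and pseudo-symmetric if $2\mathrm{g}(H)=\mathrm{F}(H)+2$. $H$ is proportionally modular if there are positive integers $p,q,r$ such that $H$ is the set of all $x\in\mathbb{N}$ with $(px \bmod q)\le rx$. By a known characterization, a numerical semigroup minimally generated by three elements is proportionally modular if and only if its generators can be arranged as $a,b,c$ with $\gcd(a,b)=\gcd(b,c)=1$ and $b\mid a+c$. It is known that for a non-symmetric $H=\langle a,b,c\rangle$ with three minimal generators, the kernel of $\varphi$ is generated by the $2\times2$ minors of a matrix $\begin{pmatrix} X^{\alpha} & Y^{\beta} & Z^{\gamma}\\ Y^{\beta'} & Z^{\gamma'} & X^{\alpha'}\end{pmatrix}$ with uniquely determined positive integer exponents; in the arranged proportionally modular case $\alpha=\gamma'=1$. Then $(\alpha+\alpha')a=\beta'b+\gamma c$, $(\beta+\beta')b=\alpha a+\gamma' c$, $(\gamma+\gamma')c=\alpha'a+\beta b$, and $a=\beta\gamma+\beta'\gamma+\beta'\gamma'$, $b=\gamma\alpha+\gamma'\alpha+\gamma'\alpha'$, $c=\alpha\beta+\alpha'\beta+\alpha'\beta'$. *)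

theory Defs
  imports
    Complex_Main
    "HOL-Computational_Algebra.Polynomial"
    "HOL-Library.Poly_Mapping"
    "HOL-Library.Product_Plus"
begin

section \<open>Numerical semigroups\<close>

definition numerical_semigroup :: "nat set \<Rightarrow> bool" where
  "numerical_semigroup H \<longleftrightarrow>
     0 \<in> H \<and> (\<forall>x\<in>H. \<forall>y\<in>H. x + y \<in> H) \<and> finite (UNIV - H)"

definition genus :: "nat set \<Rightarrow> nat" where
  "genus H = card (UNIV - H)"

text \<open>
  The largest integer not in the semigroup is taken among all integers, so that
  it is \<open>-1\<close> when there are no gaps.
\<close>

definition frobenius_number :: "nat set \<Rightarrow> int" where
  "frobenius_number H = (GREATEST z. z \<notin> int ` H)"

definition symmetric_semigroup :: "nat set \<Rightarrow> bool" where
  "symmetric_semigroup H \<longleftrightarrow> 2 * int (genus H) = frobenius_number H + 1"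

definition pseudo_symmetric_semigroup :: "nat set \<Rightarrow> bool" where
  "pseudo_symmetric_semigroup H \<longleftrightarrow> 2 * int (genus H) = frobenius_number H + 2"

definition proportionally_modular :: "nat set \<Rightarrow> bool" where
  "proportionally_modular H \<longleftrightarrow>
     (\<exists>p q r :: nat. p > 0 \<and> q > 0 \<and> r > 0 \<and> H = {x. (p * x) mod q \<le> r * x})"

text \<open>Only used for finite generating sets \<open>A\<close>.\<close>

definition semigroup_generated :: "nat set \<Rightarrow> nat set" where
  "semigroup_generated A = {\<Sum>x\<in>A. n x * x | n :: nat \<Rightarrow> nat. True}"

definition minimally_generated_by :: "nat set \<Rightarrow> nat set \<Rightarrow> bool" where
  "minimally_generated_by H A \<longleftrightarrow>
     H = semigroup_generated A \<and> (\<forall>B. B \<subset> A \<longrightarrow> semigroup_generated B \<noteq> H)"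


section \<open>The polynomial ring in three variables\<close>

text \<open>
  \<open>k[X,Y,Z]\<close> is the monoid algebra of \<open>\<nat>\<^sup>3\<close> over \<open>k\<close>: finitely supported functions from
  exponent vectors to coefficients, with the convolution product.
\<close>

type_synonym 'k poly3 = "(nat \<times> nat \<times> nat) \<Rightarrow>\<^sub>0 'k"

definition const3 :: "'k::comm_ring_1 \<Rightarrow> 'k poly3" where
  "const3 s = Poly_Mapping.single (0, 0, 0) s"

definition var_X :: "'k::comm_ring_1 poly3" where
  "var_X = Poly_Mapping.single (1, 0, 0) 1"

definition var_Y :: "'k::comm_ring_1 poly3" where
  "var_Y = Poly_Mapping.single (0, 1, 0) 1"

definition var_Z :: "'k::comm_ring_1 poly3" where
  "var_Z = Poly_Mapping.single (0, 0, 1) 1"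

text \<open>
  The homomorphism of \<open>k\<close>-algebras with \<open>X \<mapsto> t\<^sup>a\<close>, \<open>Y \<mapsto> t\<^sup>b\<close>, \<open>Z \<mapsto> t\<^sup>c\<close>. Its codomain
  \<open>k[t\<^sup>a, t\<^sup>b, t\<^sup>c]\<close> is a subring of \<open>k[t]\<close>, so the kernel may be computed in \<open>k[t]\<close>.
\<close>

definition monomial_curve_hom ::
    "nat \<Rightarrow> nat \<Rightarrow> nat \<Rightarrow> 'k::comm_ring_1 poly3 \<Rightarrow> 'k poly" where
  "monomial_curve_hom a b c f =
     (\<Sum>(i, j, l) \<in> Poly_Mapping.keys f.
        smult (Poly_Mapping.lookup f (i, j, l))
          (monom 1 a ^ i * monom 1 b ^ j * monom 1 c ^ l))"

definition hom_kernel :: "('r \<Rightarrow> 's::zero) \<Rightarrow> 'r set" where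
  "hom_kernel h = {f. h f = 0}"

lemma module_ring_mult: "module ((*) :: 'r \<Rightarrow> 'r \<Rightarrow> 'r::comm_ring_1)"
  by unfold_locales (simp_all add: algebra_simps)

definition ideal_generated :: "'r::comm_ring_1 set \<Rightarrow> 'r set" where
  "ideal_generated S = module.span (*) S"

definition minors_2x3 ::
    "'r::comm_ring_1 \<times> 'r \<times> 'r \<Rightarrow> 'r \<times> 'r \<times> 'r \<Rightarrow> 'r set" where
  "minors_2x3 = (\<lambda>(u1, u2, u3) (v1, v2, v3).
     {u1 * v2 - u2 * v1, u1 * v3 - u3 * v1, u2 * v3 - u3 * v2})"


section \<open>The map is the stated algebra homomorphism\<close>

lemma monomial_curve_hom_superset:
  assumes "finite A" "Poly_Mapping.keys f \<subseteq> A"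
  shows "monomial_curve_hom a b c f =
     (\<Sum>(i, j, l)\<in>A. monom (Poly_Mapping.lookup f (i, j, l)) (a * i + b * j + c * l))"
  unfolding monomial_curve_hom_def
  by (rule sum.mono_neutral_cong_left)
     (use assms in \<open>auto simp: monom_power mult_monom smult_monom in_keys_iff\<close>)

lemma monomial_curve_hom_single:
  "monomial_curve_hom a b c (Poly_Mapping.single (i, j, l) s) =
     monom s (a * i + b * j + c * l)"
  by (subst monomial_curve_hom_superset[where A = "{(i, j, l)}"]) auto

lemma monomial_curve_hom_add:
  "monomial_curve_hom a b c (f + g) = monomial_curve_hom a b c f + monomial_curve_hom a b c g"
proof -
  let ?A = "Poly_Mapping.keys f \<union> Poly_Mapping.keys g"
  have "Poly_Mapping.keys (f + g) \<subseteq> ?A" by (rule Poly_Mapping.keys_add)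
  then show ?thesis
    by (simp add: monomial_curve_hom_superset[where A = ?A] lookup_add add_monom[symmetric]
        sum.distrib[symmetric] case_prod_beta)
qed

lemma poly3_induct [case_names single add]:
  fixes f :: "'k::comm_ring_1 poly3"
  assumes single: "\<And>i j l s. P (Poly_Mapping.single (i, j, l) s)"
    and add: "\<And>f g. P f \<Longrightarrow> P g \<Longrightarrow> P (f + g)"
  shows "P f"
proof (induction f rule: update_induct)
  case const
  show ?case using single[of 0 0 0 0] by (simp only: single_zero)
next
  case (update f m s)
  have "Poly_Mapping.update m s f = f + Poly_Mapping.single m s"
    using update.hyps
    by (intro poly_mapping_eqI)
       (auto simp: lookup_update lookup_add lookup_single when_def in_keys_iff)
  moreover have "P (Poly_Mapping.single m s)"
    using single by (cases m) auto
  ultimately show ?case using add update.IH by simp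
qed

lemma monomial_curve_hom_mult:
  "monomial_curve_hom a b c (f * g) = monomial_curve_hom a b c f * monomial_curve_hom a b c g"
proof (induction f rule: poly3_induct)
  case (single i j l s)
  show ?case
    by (induction g rule: poly3_induct)
       (simp_all add: mult_single monomial_curve_hom_single mult_monom monomial_curve_hom_add
          algebra_simps)
qed (simp add: distrib_right monomial_curve_hom_add)

lemma monomial_curve_hom_const: "monomial_curve_hom a b c (const3 s) = [:s:]"
  by (simp add: const3_def monomial_curve_hom_single monom_0)

lemma monomial_curve_hom_vars:
  "monomial_curve_hom a b c (var_X :: 'k::comm_ring_1 poly3) = monom 1 a"
  "monomial_curve_hom a b c (var_Y :: 'k::comm_ring_1 poly3) = monom 1 b"
  "monomial_curve_hom a b c (var_Z :: 'k::comm_ring_1 poly3) = monom 1 c"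
  by (simp_all add: var_X_def var_Y_def var_Z_def monomial_curve_hom_single)

end

theory Submission
  imports Defs
begin

text \<open>
  The \<open>2 \<times> 2\<close> minors reduce modulo \<open>X\<close> to the monomials \<open>Y\<^sup>d\<close>, \<open>Y\<^bsup>\<beta>'\<^esup> Z\<^sup>\<gamma>\<close>, \<open>Z\<^bsup>\<gamma>+1\<^esup>\<close>,
  so the monomials in \<open>Y\<close> and \<open>Z\<close> divisible by none of these correspond to the Apery set of
  \<open>H\<close> with respect to \<open>a\<close>. Counting them gives \<open>a = d\<gamma> + \<beta>'\<close>, and the two maximal ones show
  that the pseudo-Frobenius numbers of \<open>H\<close> are among \<open>\<gamma>c - b\<close> and \<open>\<alpha>'a - b\<close>. Now \<open>H\<close> is
  pseudo-symmetric iff one of them is twice the other; the relations between \<open>a, b, c\<close> turn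
  this into \<open>\<beta> = \<gamma> = 1\<close> or \<open>\<alpha>' = \<beta>' = 1\<close>.
\<close>

section \<open>Pseudo-Frobenius numbers\<close>

definition pseudo_frobenius :: "nat set \<Rightarrow> nat set" where
  "pseudo_frobenius H = {x. x \<notin> H \<and> (\<forall>s\<in>H. s > 0 \<longrightarrow> x + s \<in> H)}"

lemma frobenius_number_eq_Max:
  assumes "numerical_semigroup H" "H \<noteq> UNIV"
  shows "frobenius_number H = int (Max (UNIV - H))"
  unfolding frobenius_number_def
proof (rule Greatest_equality)
  have fin: "finite (UNIV - H)" and ne: "UNIV - H \<noteq> {}"
    using assms by (auto simp: numerical_semigroup_def)
  show "int (Max (UNIV - H)) \<notin> int ` H"
    using Max_in[OF fin ne] by auto
  fix z assume z: "z \<notin> int ` H"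
  show "z \<le> int (Max (UNIV - H))"
  proof (cases "z \<ge> 0")
    case True
    then obtain n where n: "z = int n" using zero_le_imp_eq_int by blast
    with z have "n \<in> UNIV - H" by auto
    then show ?thesis using Max_ge[OF fin] n by simp
  qed simp
qed

text \<open>The reflection \<open>x \<mapsto> F - x\<close> matches the gaps whose mirror image lies
  in \<open>H\<close> with the elements of \<open>H\<close> up to \<open>F\<close>. Gaps and these
  elements together number \<open>F + 1\<close>, so the gaps whose mirror image is again a gap are
  the surplus.\<close>

lemma genus_double_eq:
  assumes "numerical_semigroup H" "H \<noteq> UNIV"
  defines "F \<equiv> Max (UNIV - H)"
  shows "2 * genus H = F + 1 + card {x. x \<notin> H \<and> F - x \<notin> H}"
proof -
  let ?N = "UNIV - H" and ?P = "{x. x \<notin> H \<and> F - x \<notin> H}"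
  let ?Q = "{x. x \<notin> H \<and> F - x \<in> H}" and ?S = "H \<inter> {..F}"
  have fin: "finite ?N" and ne: "?N \<noteq> {}" and sum: "\<And>x y. x \<in> H \<Longrightarrow> y \<in> H \<Longrightarrow> x + y \<in> H"
    using assms by (auto simp: numerical_semigroup_def)
  have FN: "F \<notin> H" using Max_in[OF fin ne] by (simp add: F_def)
  \<comment> \<open>Hence the truncated difference \<open>F - x\<close> is exact on gaps.\<close>
  have le: "x \<le> F" if "x \<notin> H" for x using Max_ge[OF fin] that by (simp add: F_def)
  have "bij_betw (\<lambda>x. F - x) ?Q ?S"
  proof (rule bij_betw_byWitness[where f' = "\<lambda>x. F - x"])
    show "(\<lambda>x. F - x) ` ?S \<subseteq> ?Q"
    proof (rule image_subsetI)
      fix x assume "x \<in> ?S"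
      then have x: "x \<in> H" "x \<le> F" by auto
      have "F - x \<notin> H"
      proof
        assume "F - x \<in> H"
        then have "F \<in> H" using sum[of "F - x" x] x by simp
        then show False using FN by simp
      qed
      then show "F - x \<in> ?Q" using x by simp
    qed
  qed (use le in auto)
  then have QS: "card ?Q = card ?S" by (rule bij_betw_same_card)
  have "card ?N = card ?P + card ?Q"
  proof -
    have "?N = ?P \<union> ?Q" by auto
    moreover have "finite ?P" "finite ?Q" using fin by (auto elim: rev_finite_subset)
    ultimately show ?thesis using card_Un_disjoint[of ?P ?Q] by auto
  qed
  moreover have "card ?N + card ?S = F + 1"
  proof -
    have "{..F} = ?N \<union> ?S" using le by auto
    then have "card {..F} = card ?N + card ?S"
      using card_Un_disjoint[of ?N ?S] fin by auto
    then show ?thesis by simp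
  qed
  ultimately show ?thesis using QS by (simp add: genus_def)
qed

text \<open>Only finitely many \<open>s\<close> in \<open>H\<close> leave \<open>x + s\<close> a
  gap, and the largest of them works.\<close>

lemma ex_pseudo_frobenius_above:
  assumes "numerical_semigroup H" "x \<notin> H"
  obtains s where "s \<in> H" "x + s \<in> pseudo_frobenius H"
proof -
  let ?A = "{s \<in> H. x + s \<notin> H}"
  have sum: "\<And>x y. x \<in> H \<Longrightarrow> y \<in> H \<Longrightarrow> x + y \<in> H" and "0 \<in> H" "finite (UNIV - H)"
    using assms by (auto simp: numerical_semigroup_def)
  then have "finite ((+) x ` ?A)" by (auto elim: rev_finite_subset)
  then have fin: "finite ?A" by (rule finite_imageD) simp
  have "0 \<in> ?A" using \<open>0 \<in> H\<close> assms by simp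
  then have s: "Max ?A \<in> ?A" using fin Max_in by blast
  have "x + Max ?A + t \<in> H" if "t \<in> H" "t > 0" for t
  proof (rule ccontr)
    assume "x + Max ?A + t \<notin> H"
    then have "Max ?A + t \<in> ?A" using s sum that by (simp add: add.assoc)
    then have "Max ?A + t \<le> Max ?A" using fin Max_ge by blast
    then show False using that by simp
  qed
  then have "x + Max ?A \<in> pseudo_frobenius H" using s by (simp add: pseudo_frobenius_def)
  with that show thesis using s by blast
qed

lemma pseudo_symmetric_iff_card:
  assumes "numerical_semigroup H" "H \<noteq> UNIV"
  shows "pseudo_symmetric_semigroup H \<longleftrightarrow> card {x. x \<notin> H \<and> Max (UNIV - H) - x \<notin> H} = 1"
  using genus_double_eq[OF assms] frobenius_number_eq_Max[OF assms]
  by (auto simp: pseudo_symmetric_semigroup_def)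

lemma Max_gap_pseudo_frobenius:
  assumes "numerical_semigroup H" "H \<noteq> UNIV"
  shows "Max (UNIV - H) \<in> pseudo_frobenius H"
proof -
  have fin: "finite (UNIV - H)" and ne: "UNIV - H \<noteq> {}"
    using assms by (auto simp: numerical_semigroup_def)
  have "Max (UNIV - H) + s \<in> H" if "s > 0" for s
    using Max_ge[OF fin, of "Max (UNIV - H) + s"] that by auto
  then show ?thesis using Max_in[OF fin ne] by (simp add: pseudo_frobenius_def)
qed

text \<open>The only gap whose mirror image is a gap is fixed by the reflection, so
  \<open>F = 2 * x\<close>. If \<open>x + s\<close> were a gap for a positive \<open>s\<close> in
  \<open>H\<close>, its mirror image would lie in \<open>H\<close>, and adding \<open>s\<close>
  would put \<open>F - x\<close> in \<open>H\<close>.\<close>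

lemma pseudo_symmetricE:
  assumes ns: "numerical_semigroup H" and nU: "H \<noteq> UNIV" and "pseudo_symmetric_semigroup H"
  obtains x where "x \<in> pseudo_frobenius H" "2 * x = Max (UNIV - H)"
proof -
  let ?F = "Max (UNIV - H)" and ?P = "{x. x \<notin> H \<and> Max (UNIV - H) - x \<notin> H}"
  have sum: "\<And>x y. x \<in> H \<Longrightarrow> y \<in> H \<Longrightarrow> x + y \<in> H" and fin: "finite (UNIV - H)"
    using ns by (auto simp: numerical_semigroup_def)
  have le: "x \<le> ?F" if "x \<notin> H" for x using Max_ge[OF fin] that by simp
  obtain x where P: "?P = {x}"
    using assms pseudo_symmetric_iff_card card_1_singletonE by metis
  then have x: "x \<notin> H" "?F - x \<notin> H" by auto
  then have "?F - x \<in> ?P" using le[of x] by simp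
  then have "?F - x = x" using P by blast
  then have twice: "2 * x = ?F" using le[of x] x by simp
  have "x + s \<in> H" if s: "s \<in> H" "s > 0" for s
  proof (rule ccontr)
    assume gap: "x + s \<notin> H"
    have "x + s \<notin> ?P" using P s by auto
    then have "?F - (x + s) \<in> H" using gap by blast
    then have "?F - (x + s) + s \<in> H" using s sum by blast
    moreover have "?F - (x + s) + s = ?F - x" using le[OF gap] by simp
    ultimately show False using x by simp
  qed
  then have "x \<in> pseudo_frobenius H" using x by (simp add: pseudo_frobenius_def)
  then show thesis using that twice by blast
qed

text \<open>A gap \<open>y\<close> whose mirror image is also a gap lies below a pseudo-Frobenius
  number \<open>y + s\<close> other than \<open>F\<close>, hence \<open>y \<le> x\<close>. The same
  bound for \<open>F - y\<close> forces \<open>y = x\<close>.\<close>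

lemma pseudo_symmetricI:
  assumes ns: "numerical_semigroup H" and "x \<notin> H" and twice: "2 * x = Max (UNIV - H)"
    and PF: "pseudo_frobenius H \<subseteq> {x, 2 * x}"
  shows "pseudo_symmetric_semigroup H"
proof -
  let ?F = "Max (UNIV - H)"
  have nU: "H \<noteq> UNIV" using \<open>x \<notin> H\<close> by blast
  have fin: "finite (UNIV - H)" using ns by (simp add: numerical_semigroup_def)
  have le: "y \<le> ?F" if "y \<notin> H" for y using Max_ge[OF fin] that by simp
  have below: "y \<le> x" if y: "y \<notin> H" "?F - y \<notin> H" for y
  proof -
    obtain s where s: "s \<in> H" "y + s \<in> pseudo_frobenius H"
      using ex_pseudo_frobenius_above[OF ns y(1)] by blast
    have "y + s \<noteq> ?F" using s(1) y(2) by (metis add_diff_cancel_left')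
    then have "y + s = x" using s PF twice by auto
    then show ?thesis by simp
  qed
  have "y = x" if y: "y \<notin> H" "?F - y \<notin> H" for y
  proof -
    have "?F - (?F - y) \<notin> H" using y le[of y] by simp
    then have "?F - y \<le> x" using below y by blast
    with below[OF y] twice show ?thesis by linarith
  qed
  moreover have "x \<in> {y. y \<notin> H \<and> ?F - y \<notin> H}"
    using \<open>x \<notin> H\<close> twice[symmetric] by simp
  ultimately have "{y. y \<notin> H \<and> ?F - y \<notin> H} = {x}" by blast
  then show ?thesis using pseudo_symmetric_iff_card[OF ns nU] by simp
qed

section \<open>The kernel of the monomial map\<close>

lemma monomial_curve_hom_diff:
  "monomial_curve_hom a b c (f - g) = monomial_curve_hom a b c f - monomial_curve_hom a b c g"
  using monomial_curve_hom_add[of a b c "f - g" g] by simp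

lemma var_powers:
  "(var_X :: 'k::comm_ring_1 poly3) ^ n = Poly_Mapping.single (n, 0, 0) 1"
  "(var_Y :: 'k::comm_ring_1 poly3) ^ n = Poly_Mapping.single (0, n, 0) 1"
  "(var_Z :: 'k::comm_ring_1 poly3) ^ n = Poly_Mapping.single (0, 0, n) 1"
  by (induction n)
     (simp_all add: var_X_def var_Y_def var_Z_def mult_single single_one[symmetric] zero_prod_def)

lemma ideal_generated_superset: "S \<subseteq> ideal_generated S"
  unfolding ideal_generated_def by (rule module.span_superset[OF module_ring_mult])

text \<open>The complement of \<open>D\<close> absorbs addition, so the polynomials supported there
  form a monomial ideal. Once this ideal contains \<open>S\<close>, it contains everything that
  \<open>S\<close> generates.\<close>

lemma ideal_generated_avoids_keys:
  fixes S :: "('m::comm_monoid_add \<Rightarrow>\<^sub>0 'k::comm_ring_1) set"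
  assumes down: "\<And>x y. x + y \<in> D \<Longrightarrow> y \<in> D"
    and S: "\<And>g. g \<in> S \<Longrightarrow> Poly_Mapping.keys g \<inter> D = {}"
    and f: "f \<in> ideal_generated S"
  shows "Poly_Mapping.keys f \<inter> D = {}"
proof -
  have "module.subspace (*) {g :: 'm \<Rightarrow>\<^sub>0 'k. Poly_Mapping.keys g \<inter> D = {}}"
    unfolding module.subspace_def[OF module_ring_mult]
  proof (intro conjI ballI allI CollectI)
    fix g h :: "'m \<Rightarrow>\<^sub>0 'k"
    assume "h \<in> {g. Poly_Mapping.keys g \<inter> D = {}}"
    then show "Poly_Mapping.keys (g * h) \<inter> D = {}"
      using keys_mult[of g h] down by blast
  next
    fix g h :: "'m \<Rightarrow>\<^sub>0 'k"
    assume "g \<in> {g. Poly_Mapping.keys g \<inter> D = {}}" "h \<in> {g. Poly_Mapping.keys g \<inter> D = {}}"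
    then show "Poly_Mapping.keys (g + h) \<inter> D = {}"
      using Poly_Mapping.keys_add[of g h] by blast
  qed simp
  then show ?thesis
    using module.span_minimal[OF module_ring_mult, of S "{g. Poly_Mapping.keys g \<inter> D = {}}"] S f
    unfolding ideal_generated_def by blast
qed

lemma keys_binomial_disjoint:
  assumes "p \<notin> D" "q \<notin> D"
  shows "Poly_Mapping.keys (Poly_Mapping.single p (1 :: 'k::comm_ring_1) - Poly_Mapping.single q 1)
     \<inter> D = {}"
  using assms
  by (auto simp: in_keys_iff lookup_minus lookup_single when_def split: if_splits)

lemma semigroup_generated_three:
  assumes "card {a, b, c} = 3"
  shows "n \<in> semigroup_generated {a, b, c} \<longleftrightarrow> (\<exists>u v w. n = a * u + b * v + c * w)"
proof
  have dist: "a \<noteq> b" "a \<noteq> c" "b \<noteq> c" using assms by (auto simp: card_insert_if split: if_splits)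
  show "\<exists>u v w. n = a * u + b * v + c * w" if "n \<in> semigroup_generated {a, b, c}"
    using that dist by (auto simp: semigroup_generated_def algebra_simps) (metis mult.commute)
  assume "\<exists>u v w. n = a * u + b * v + c * w"
  then obtain u v w where n: "n = a * u + b * v + c * w" by blast
  have "n = (\<Sum>x\<in>{a, b, c}. (if x = a then u else if x = b then v else w) * x)"
    using dist n by (simp add: algebra_simps)
  then show "n \<in> semigroup_generated {a, b, c}"
    unfolding semigroup_generated_def
    by (intro CollectI exI[of _ "\<lambda>x. if x = a then u else if x = b then v else w"]) simp
qed

text \<open>
  For \<open>e \<le> d\<close> these are the pairs \<open>(j, l)\<close> with
  \<open>Y\<^sup>j Z\<^sup>l \<notin> \<langle>X, Y\<^sup>d, Y\<^sup>e Z\<^sup>\<gamma>, Z\<^bsup>\<gamma>+1\<^esup>\<rangle>\<close>.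
\<close>
definition standard_exponents :: "nat \<Rightarrow> nat \<Rightarrow> nat \<Rightarrow> (nat \<times> nat) set" where
  "standard_exponents d \<gamma> e = {..<d} \<times> {..<\<gamma>} \<union> {..<e} \<times> {\<gamma>}"

lemma card_standard_exponents: "card (standard_exponents d \<gamma> e) = d * \<gamma> + e"
  unfolding standard_exponents_def
  by (subst card_Un_disjoint) (auto simp: card_cartesian_product)

text \<open>The two terms of each minor have equal degree because the minor lies in the kernel; this
  gives the three relations. For the last claim, \<open>Y^j Z^l - X^u Y^v Z^w\<close> lies in the
  ideal of the minors, no element of which contains a standard monomial, so its two terms must
  cancel.\<close>

lemma kernel_relations:
  fixes a b c \<beta> \<gamma> \<alpha>' \<beta>' :: nat
  assumes pos: "\<beta> > 0" "\<gamma> > 0" "\<alpha>' > 0" "\<beta>' > 0"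
    and ker: "hom_kernel (monomial_curve_hom a b c :: 'k::field poly3 \<Rightarrow> 'k poly) =
         ideal_generated (minors_2x3 (var_X, var_Y ^ \<beta>, var_Z ^ \<gamma>)
                                     (var_Y ^ \<beta>', var_Z, var_X ^ \<alpha>'))"
  shows "a + c = b * (\<beta> + \<beta>')" "a * (1 + \<alpha>') = b * \<beta>' + c * \<gamma>" "a * \<alpha>' + b * \<beta> = c * (\<gamma> + 1)"
    and "(j, l) \<in> standard_exponents (\<beta> + \<beta>') \<gamma> \<beta>' \<Longrightarrow>
           b * j + c * l = a * u + b * v + c * w \<Longrightarrow> u = 0 \<and> v = j \<and> w = l"
proof -
  let ?hom = "monomial_curve_hom a b c :: 'k poly3 \<Rightarrow> 'k poly"
  let ?m = "\<lambda>p. Poly_Mapping.single p (1 :: 'k)"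
  define M :: "'k poly3 set" where "M = {?m (1, 0, 1) - ?m (0, \<beta> + \<beta>', 0),
    ?m (1 + \<alpha>', 0, 0) - ?m (0, \<beta>', \<gamma>), ?m (\<alpha>', \<beta>, 0) - ?m (0, 0, \<gamma> + 1)}"
  have "minors_2x3 (var_X :: 'k poly3, var_Y ^ \<beta>, var_Z ^ \<gamma>) (var_Y ^ \<beta>', var_Z, var_X ^ \<alpha>') = M"
    unfolding minors_2x3_def M_def var_powers
    by (simp add: var_X_def var_Z_def mult_single add.commute)
  with ker have kerM: "hom_kernel ?hom = ideal_generated M" by simp
  have binomial: "?m (i, j, l) - ?m (u, v, w) \<in> hom_kernel ?hom \<longleftrightarrow>
      a * i + b * j + c * l = a * u + b * v + c * w" for i j l u v w
    by (simp add: hom_kernel_def monomial_curve_hom_diff monomial_curve_hom_single)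
       (metis degree_monom_eq one_neq_zero)
  have "M \<subseteq> hom_kernel ?hom" using ideal_generated_superset kerM by simp
  then have "?m (1, 0, 1) - ?m (0, \<beta> + \<beta>', 0) \<in> hom_kernel ?hom"
    "?m (1 + \<alpha>', 0, 0) - ?m (0, \<beta>', \<gamma>) \<in> hom_kernel ?hom"
    "?m (\<alpha>', \<beta>, 0) - ?m (0, 0, \<gamma> + 1) \<in> hom_kernel ?hom"
    by (simp_all add: M_def)
  then show "a + c = b * (\<beta> + \<beta>')" "a * (1 + \<alpha>') = b * \<beta>' + c * \<gamma>"
    "a * \<alpha>' + b * \<beta> = c * (\<gamma> + 1)"
    by (simp_all only: binomial mult_0_right mult_1_right add_0_left add_0_right)
  assume jl: "(j, l) \<in> standard_exponents (\<beta> + \<beta>') \<gamma> \<beta>'"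
    and eq: "b * j + c * l = a * u + b * v + c * w"
  let ?D = "{0 :: nat} \<times> standard_exponents (\<beta> + \<beta>') \<gamma> \<beta>'"
  have "?m (0, j, l) - ?m (u, v, w) \<in> ideal_generated M"
    using eq by (simp add: binomial flip: kerM)
  \<comment> \<open>Every term of a minor contains \<open>X\<close> or is one of the three monomials
    in \<open>Y\<close> and \<open>Z\<close> that bound the staircase of standard exponents.\<close>
  moreover have "Poly_Mapping.keys g \<inter> ?D = {}" if "g \<in> M" for g
    using that pos unfolding M_def
    by (elim insertE emptyE; hypsubst; intro keys_binomial_disjoint)
       (auto simp: standard_exponents_def)
  moreover have "y \<in> ?D" if "x + y \<in> ?D" for x y
    using that by (cases x; cases y) (auto simp: standard_exponents_def)
  ultimately have "Poly_Mapping.keys (?m (0, j, l) - ?m (u, v, w)) \<inter> ?D = {}"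
    using ideal_generated_avoids_keys[of ?D M] by blast
  then have "(0, j, l) \<notin> Poly_Mapping.keys (?m (0, j, l) - ?m (u, v, w))"
    using jl by blast
  then show "u = 0 \<and> v = j \<and> w = l"
    by (auto simp: in_keys_iff lookup_minus lookup_single when_def split: if_splits)
qed

section \<open>The semigroup of three generators\<close>

text \<open>Keeps the numerical content of the kernel hypothesis; polynomials do not occur again
  until the final theorem.\<close>

locale monomial_curve_semigroup =
  fixes H :: "nat set" and a b c d \<beta> \<gamma> \<alpha>' \<beta>' :: nat
  assumes H_iff: "n \<in> H \<longleftrightarrow> (\<exists>u v w. n = a * u + b * v + c * w)"
    and coprime_ab: "coprime a b"
    and exponents_pos: "\<beta> > 0" "\<gamma> > 0" "\<alpha>' > 0" "\<beta>' > 0"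
    and d_eq: "d = \<beta> + \<beta>'"
    and generators_pos: "a > 0" "b > 0" "c > 0"
    and relation_b: "a + c = b * d"
    and relation_a: "a * (1 + \<alpha>') = b * \<beta>' + c * \<gamma>"
    and relation_c: "a * \<alpha>' + b * \<beta> = c * (\<gamma> + 1)"
    and standard_unique: "(j, l) \<in> standard_exponents d \<gamma> \<beta>' \<Longrightarrow>
           b * j + c * l = a * u + b * v + c * w \<Longrightarrow> u = 0 \<and> v = j \<and> w = l"
begin

text \<open>Coprimality makes \<open>a\<close> divide \<open>d * \<gamma> + \<beta>'\<close>. That
  is also the number of standard exponents, whose values are distinct modulo \<open>a\<close>, which
  gives the opposite inequality.\<close>

lemma generators_eq: "a = d * \<gamma> + \<beta>'" "c = \<beta> + \<alpha>' * d"
proof -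
  let ?A = "d * \<gamma> + \<beta>'" and ?L = "standard_exponents d \<gamma> \<beta>'"
  \<comment> \<open>Sum of \<open>relation_a\<close> and \<open>\<gamma>\<close> times
    \<open>relation_b\<close>; likewise \<open>C\<close> is \<open>relation_c\<close> plus
    \<open>\<alpha>'\<close> times \<open>relation_b\<close>.\<close>
  have A: "a * (1 + \<alpha>' + \<gamma>) = b * ?A"
  proof -
    have "a * (1 + \<alpha>' + \<gamma>) + c * \<gamma> = a * (1 + \<alpha>') + (a + c) * \<gamma>" by (simp add: algebra_simps)
    also have "\<dots> = b * ?A + c * \<gamma>" unfolding relation_a relation_b by (simp add: algebra_simps)
    finally show ?thesis by simp
  qed
  have C: "c * (1 + \<alpha>' + \<gamma>) = b * (\<beta> + \<alpha>' * d)"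
  proof -
    have "c * (1 + \<alpha>' + \<gamma>) + a * \<alpha>' = c * (\<gamma> + 1) + (a + c) * \<alpha>'" by (simp add: algebra_simps)
    also have "\<dots> = b * (\<beta> + \<alpha>' * d) + a * \<alpha>'"
      unfolding relation_c[symmetric] relation_b by (simp add: algebra_simps)
    finally show ?thesis by simp
  qed
  have "a dvd b * ?A" using A by (metis dvd_triv_left)
  then have "a dvd ?A" using coprime_ab coprime_dvd_mult_right_iff by blast
  then have "a \<le> ?A" using exponents_pos by (intro dvd_imp_le) auto
  moreover have "?A \<le> a"
  proof -
    \<comment> \<open>The larger of two congruent values is the smaller one plus a multiple of
      \<open>a\<close>, which would be a second factorization of a standard value.\<close>
    have unique: "(j, l) = (j', l')"
      if L: "(j, l) \<in> ?L" and le: "b * j' + c * l' \<le> b * j + c * l"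
        and cong: "(b * j + c * l) mod a = (b * j' + c * l') mod a" for j l j' l'
    proof -
      have "a dvd (b * j + c * l) - (b * j' + c * l')"
        using cong le by (metis mod_eq_dvd_iff_nat)
      then obtain u where "(b * j + c * l) - (b * j' + c * l') = a * u" by (rule dvdE)
      then have "b * j + c * l = a * u + b * j' + c * l'" using le by linarith
      then show ?thesis using standard_unique[OF L] by simp
    qed
    have "inj_on (\<lambda>(j, l). (b * j + c * l) mod a) ?L"
    proof (rule inj_onI, clarify)
      fix j l j' l'
      assume "(j, l) \<in> ?L" "(j', l') \<in> ?L" "(b * j + c * l) mod a = (b * j' + c * l') mod a"
      then show "j = j' \<and> l = l'" using unique[of j l j' l'] unique[of j' l' j l]
        by (metis nat_le_linear prod.inject)
    qed
    moreover have "(\<lambda>(j, l). (b * j + c * l) mod a) ` ?L \<subseteq> {..<a}"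
      using generators_pos by auto
    ultimately have "card ?L \<le> card {..<a}" by (intro card_inj_on_le) auto
    then show ?thesis by (simp add: card_standard_exponents)
  qed
  ultimately show a: "a = ?A" by simp
  \<comment> \<open>Cancelling \<open>a\<close> in \<open>A\<close> determines \<open>b\<close>, and
    this turns the left side of \<open>C\<close> into \<open>c * b\<close>.\<close>
  have "1 + \<alpha>' + \<gamma> = b" using A generators_pos unfolding a[symmetric] mult.commute[of b a]
    by (simp only: mult_cancel1) simp
  then show "c = \<beta> + \<alpha>' * d" using C generators_pos unfolding mult.commute[of c]
    by (simp only: mult_cancel1) simp
qed

section \<open>The Apery set with respect to \<open>a\<close> and its maximal elements\<close>

lemma standard_minus_a_gap:
  assumes "(j, l) \<in> standard_exponents d \<gamma> \<beta>'" "x + a = b * j + c * l"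
  shows "x \<notin> H"
proof
  assume "x \<in> H"
  then obtain u v w where "x = a * u + b * v + c * w" using H_iff by blast
  then have "b * j + c * l = a * (u + 1) + b * v + c * w" using assms(2) by simp
  then have "u + 1 = 0" using standard_unique[OF assms(1)] by blast
  then show False by simp
qed

text \<open>No factorization of \<open>x + a\<close> involves \<open>a\<close>, since removing one
  \<open>a\<close> would put \<open>x\<close> in \<open>H\<close>. If a bound on the exponents
  failed, one of the three relations would introduce such an \<open>a\<close>.\<close>

lemma gap_plus_a_standard:
  assumes "x \<notin> H" "x + a \<in> H"
  obtains j l where "(j, l) \<in> standard_exponents d \<gamma> \<beta>'" "x + a = b * j + c * l"
proof -
  obtain u v w where uvw: "x + a = a * u + b * v + c * w" using assms H_iff by blast
  have no_a: "x + a \<noteq> a * (u + 1) + b * v + c * w" for u v w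
  proof
    assume "x + a = a * (u + 1) + b * v + c * w"
    then have "x = a * u + b * v + c * w" by simp
    then show False using assms(1) H_iff by blast
  qed
  then have u: "u = 0" using uvw by (metis Suc_eq_plus1 not0_implies_Suc)
  have "v < d"
  proof (rule ccontr)
    assume "\<not> v < d"
    then obtain e where "v = d + e" using le_Suc_ex not_less by blast
    then have "x + a = a * (0 + 1) + b * e + c * (w + 1)"
      using uvw u relation_b by (simp add: algebra_simps)
    then show False using no_a by blast
  qed
  moreover have "w \<le> \<gamma>"
  proof (rule ccontr)
    assume "\<not> w \<le> \<gamma>"
    then obtain e where "w = \<gamma> + 1 + e" using le_Suc_ex not_less_eq_eq by (metis Suc_eq_plus1)
    \<comment> \<open>Positivity of \<open>\<alpha>'\<close> ensures that trading
      \<open>c * (\<gamma> + 1)\<close> through \<open>relation_c\<close> does produce an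
      \<open>a\<close>.\<close>
    moreover obtain f where "\<alpha>' = f + 1" using exponents_pos by (metis Suc_eq_plus1 gr0_implies_Suc)
    ultimately have "x + a = a * (f + 1) + b * (\<beta> + v) + c * e"
      using uvw u relation_c by (simp add: algebra_simps)
    then show False using no_a by blast
  qed
  moreover have "v < \<beta>'" if "w = \<gamma>"
  proof (rule ccontr)
    assume "\<not> v < \<beta>'"
    then obtain e where "v = \<beta>' + e" using le_Suc_ex not_less by blast
    then have "x + a = a * (\<alpha>' + 1) + b * e + c * 0"
      using uvw u relation_a that by (simp add: algebra_simps)
    then show False using no_a by blast
  qed
  ultimately have "(v, w) \<in> standard_exponents d \<gamma> \<beta>'"
    by (auto simp: standard_exponents_def)
  then show thesis using that uvw u by simp
qed

text \<open>Here \<open>x + a\<close> is the value of a standard pair, and membership of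
  \<open>x + b\<close> and \<open>x + c\<close> in \<open>H\<close> forbids a step up in either
  coordinate. The staircase has just two such corners, \<open>(\<beta>' - 1, \<gamma>)\<close> and
  \<open>(d - 1, \<gamma> - 1)\<close>.\<close>

lemma pseudo_frobenius_cases:
  assumes "x \<in> pseudo_frobenius H"
  shows "x + b = c * \<gamma> \<or> x + b = a * \<alpha>'"
proof -
  let ?L = "standard_exponents d \<gamma> \<beta>'"
  have "a \<in> H" "b \<in> H" "c \<in> H" using H_iff
    by (metis add_0_left add_0_right mult_0_right mult_1_right)+
  then have x: "x \<notin> H" "x + a \<in> H" "x + b \<in> H" "x + c \<in> H"
    using assms generators_pos by (auto simp: pseudo_frobenius_def)
  obtain j l where jl: "(j, l) \<in> ?L" "x + a = b * j + c * l"
    using gap_plus_a_standard x(1,2) by blast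
  have "x + b + a = b * (j + 1) + c * l" "x + c + a = b * j + c * (l + 1)" using jl(2) by simp_all
  then have max: "(j + 1, l) \<notin> ?L" "(j, l + 1) \<notin> ?L" using standard_minus_a_gap x by blast+
  show ?thesis
  proof (cases "l = \<gamma>")
    case True
    then have "\<beta>' = j + 1" using jl(1) max by (auto simp: standard_exponents_def)
    then have "x + b + a = a * (1 + \<alpha>')" using jl(2) True relation_a by simp
    then show ?thesis by simp
  next
    case False
    then have "d = j + 1" "\<gamma> = l + 1" using jl(1) max by (auto simp: standard_exponents_def)
    then have "x + b + (a + c) = c * \<gamma> + b * d" using jl(2) by simp
    then show ?thesis using relation_b by simp
  qed
qed

lemma pseudo_frobenius_candidates_gap:
  "x + b = c * \<gamma> \<Longrightarrow> x \<notin> H" "x + b = a * \<alpha>' \<Longrightarrow> x \<notin> H"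
proof -
  \<comment> \<open>The predecessors name the corners \<open>(e, g)\<close> and
    \<open>(f, \<gamma>)\<close> without subtraction.\<close>
  obtain e where e: "d = e + 1" using exponents_pos d_eq by (metis Suc_eq_plus1 gr0_implies_Suc add_gr_0)
  obtain f where f: "\<beta>' = f + 1" using exponents_pos by (metis Suc_eq_plus1 gr0_implies_Suc)
  obtain g where g: "\<gamma> = g + 1" using exponents_pos by (metis Suc_eq_plus1 gr0_implies_Suc)
  show "x \<notin> H" if "x + b = c * \<gamma>"
  proof (rule standard_minus_a_gap)
    show "(e, g) \<in> standard_exponents d \<gamma> \<beta>'" using e g by (auto simp: standard_exponents_def)
    have "x + a + (b + c) = c * \<gamma> + b * d" using that relation_b by simp
    then show "x + a = b * e + c * g" using e g by simp
  qed
  show "x \<notin> H" if "x + b = a * \<alpha>'"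
  proof (rule standard_minus_a_gap)
    show "(f, \<gamma>) \<in> standard_exponents d \<gamma> \<beta>'" using f by (auto simp: standard_exponents_def)
    have "x + a + b = b * \<beta>' + c * \<gamma>" using that relation_a by simp
    then show "x + a = b * f + c * \<gamma>" using f by simp
  qed
qed

section \<open>Pseudo-symmetry as doubling of one candidate\<close>

lemma double_first_iff: "c * \<gamma> + b = 2 * (a * \<alpha>') \<longleftrightarrow> \<alpha>' * \<beta>' = 1"
proof
  \<comment> \<open>For the candidates \<open>c * \<gamma> - b\<close> and
    \<open>a * \<alpha>' - b\<close> this says that the first is twice the second. Combined with
    \<open>relation_a\<close> it leaves
    \<open>b * (\<beta>' - 1) + a * (\<alpha>' - 1) = 0\<close>.\<close>
  assume eq: "c * \<gamma> + b = 2 * (a * \<alpha>')"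
  obtain f where f: "\<beta>' = f + 1" using exponents_pos by (metis Suc_eq_plus1 gr0_implies_Suc)
  obtain g where g: "\<alpha>' = g + 1" using exponents_pos by (metis Suc_eq_plus1 gr0_implies_Suc)
  have "b * f + a * g = 0"
  proof -
    have rel: "a * (1 + \<alpha>') = 2 * a + a * g" "b * \<beta>' = b * f + b" "a * \<alpha>' = a * g + a"
      using f g by simp_all
    have arith: "r + q = 0" if "p + b = 2 * (q + a)" "2 * a + q = r + b + p" for p q r :: nat
      using that by presburger
    show ?thesis by (rule arith[of "c * \<gamma>"]) (use rel eq relation_a in presburger)+
  qed
  then show "\<alpha>' * \<beta>' = 1" using f g generators_pos by simp
next
  assume "\<alpha>' * \<beta>' = 1"
  then show "c * \<gamma> + b = 2 * (a * \<alpha>')" using relation_a by simp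
qed

lemma double_second_iff: "a * \<alpha>' + b = 2 * (c * \<gamma>) \<longleftrightarrow> \<beta> * \<gamma> = 1"
proof
  \<comment> \<open>With the candidates exchanged, \<open>relation_c\<close> leaves
    \<open>b * (\<beta> - 1) + c * (\<gamma> - 1) = 0\<close>.\<close>
  assume eq: "a * \<alpha>' + b = 2 * (c * \<gamma>)"
  obtain f where f: "\<beta> = f + 1" using exponents_pos by (metis Suc_eq_plus1 gr0_implies_Suc)
  obtain g where g: "\<gamma> = g + 1" using exponents_pos by (metis Suc_eq_plus1 gr0_implies_Suc)
  have "b * f + c * g = 0"
  proof -
    have rel: "c * (\<gamma> + 1) = 2 * c + c * g" "b * \<beta> = b * f + b" "c * \<gamma> = c * g + c"
      using f g by simp_all
    have arith: "r + q = 0" if "p + b = 2 * (q + c)" "p + (r + b) = 2 * c + q" for p q r :: nat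
      using that by presburger
    show ?thesis by (rule arith[of "a * \<alpha>'"]) (use rel eq relation_c in presburger)+
  qed
  then show "\<beta> * \<gamma> = 1" using f g generators_pos by simp
next
  assume "\<beta> * \<gamma> = 1"
  then show "a * \<alpha>' + b = 2 * (c * \<gamma>)" using relation_c by simp
qed

lemma pseudo_symmetric_iff_exponents:
  assumes ns: "numerical_semigroup H" and nU: "H \<noteq> UNIV"
  shows "pseudo_symmetric_semigroup H \<longleftrightarrow> \<beta> * \<gamma> = 1 \<or> \<alpha>' * \<beta>' = 1"
proof
  let ?F = "Max (UNIV - H)"
  have fin: "finite (UNIV - H)" and "0 \<in> H" using ns by (auto simp: numerical_semigroup_def)
  have F: "?F \<in> pseudo_frobenius H" using Max_gap_pseudo_frobenius[OF ns nU] .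
  then have F_cases: "?F + b = c * \<gamma> \<or> ?F + b = a * \<alpha>'" by (rule pseudo_frobenius_cases)
  have "?F \<notin> H" using F by (simp add: pseudo_frobenius_def)
  \<comment> \<open>Positivity excludes \<open>x = F\<close> when \<open>F = 2 * x\<close>, so
    \<open>x\<close> and \<open>F\<close> are different candidates.\<close>
  then have F_pos: "?F > 0" using \<open>0 \<in> H\<close> by (metis gr0I)
  {
    assume "pseudo_symmetric_semigroup H"
    then obtain x where x: "x \<in> pseudo_frobenius H" "2 * x = ?F"
      using pseudo_symmetricE[OF ns nU] by blast
    then have "c * \<gamma> + b = 2 * (a * \<alpha>') \<or> a * \<alpha>' + b = 2 * (c * \<gamma>)"
      using pseudo_frobenius_cases[OF x(1)] F_cases F_pos by linarith
    then show "\<beta> * \<gamma> = 1 \<or> \<alpha>' * \<beta>' = 1" using double_first_iff double_second_iff by blast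
  }
  \<comment> \<open>Arbitrary \<open>p\<close> and \<open>q\<close> serve both orders of the
    candidates: \<open>q\<close> yields \<open>x\<close>, and \<open>p\<close> yields
    \<open>2 * x\<close>.\<close>
  have sufficient: "pseudo_symmetric_semigroup H"
    if eq: "p + b = 2 * q"
      and cases: "\<And>x. x \<in> pseudo_frobenius H \<Longrightarrow> x + b = p \<or> x + b = q"
      and gap: "\<And>x. x + b = p \<Longrightarrow> x \<notin> H" "\<And>x. x + b = q \<Longrightarrow> x \<notin> H" for p q
  proof -
    have "b \<le> q" using cases[OF F] eq by linarith
    then obtain x where x: "x + b = q" by (metis add.commute le_Suc_ex)
    then have p: "2 * x + b = p" using eq by linarith
    \<comment> \<open>As a gap, \<open>2 * x\<close> is at most \<open>F\<close>, and
      \<open>F\<close> is itself \<open>x\<close> or \<open>2 * x\<close>.\<close>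
    have "2 * x \<le> ?F" using gap(1)[OF p] Max_ge[OF fin] by blast
    then have "2 * x = ?F" using cases[OF F] x p by linarith
    moreover have "pseudo_frobenius H \<subseteq> {x, 2 * x}"
    proof
      fix y assume "y \<in> pseudo_frobenius H"
      then have "y + b = p \<or> y + b = q" by (rule cases)
      then show "y \<in> {x, 2 * x}" using x p by auto
    qed
    ultimately show ?thesis using pseudo_symmetricI[OF ns gap(2)[OF x]] by blast
  qed
  assume "\<beta> * \<gamma> = 1 \<or> \<alpha>' * \<beta>' = 1"
  then show "pseudo_symmetric_semigroup H"
    using double_first_iff double_second_iff pseudo_frobenius_cases pseudo_frobenius_candidates_gap
      sufficient[of "c * \<gamma>" "a * \<alpha>'"] sufficient[of "a * \<alpha>'" "c * \<gamma>"] by blast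
qed

section \<open>The criterion in terms of \<open>d\<close>\<close>

lemma exponents_iff_d:
  "\<beta> * \<gamma> = 1 \<or> \<alpha>' * \<beta>' = 1 \<longleftrightarrow> 2 * d = a + 1 \<or> 2 * d = c + 1"
proof -
  \<comment> \<open>Both formulas of \<open>generators_eq\<close> have the shape
    \<open>(p + q) * g + q\<close>, with the roles of \<open>\<beta>\<close> and
    \<open>\<beta>'\<close> exchanged. A factor \<open>g \<ge> 2\<close> makes the right side too
    large, and \<open>g = 1\<close> forces \<open>p = 1\<close>.\<close>
  have arith: "2 * (p + q) = (p + q) * g + q + 1 \<longleftrightarrow> p * g = 1"
    if "p > 0" "q > 0" "g > 0" for p q g :: nat
  proof (cases "g = 1")
    case False
    then have "(p + q) * 2 \<le> (p + q) * g" using \<open>g > 0\<close> by (intro mult_le_mono) auto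
    then have "2 * (p + q) \<noteq> (p + q) * g + q + 1" by linarith
    then show ?thesis using False by simp
  qed auto
  have "2 * d = a + 1 \<longleftrightarrow> \<beta> * \<gamma> = 1"
    using arith[of \<beta> \<beta>' \<gamma>] exponents_pos by (simp only: generators_eq d_eq)
  moreover have "2 * d = c + 1 \<longleftrightarrow> \<beta>' * \<alpha>' = 1"
    using arith[of \<beta>' \<beta> \<alpha>'] exponents_pos by (simp only: generators_eq d_eq ac_simps)
  ultimately show ?thesis by (simp add: mult.commute)
qed

end

theorem corollary5p3:
  fixes H :: "nat set"
    and a b c d :: nat
    and \<beta> \<gamma> \<alpha>' \<beta>' :: nat
  assumes "numerical_semigroup H"
    and "proportionally_modular H"
    and "card {a, b, c} = 3"
    and "minimally_generated_by H {a, b, c}"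
    and "\<not> symmetric_semigroup H"
    and "gcd a b = 1"
    and "gcd b c = 1"
    and "d \<ge> 2"
    and "d * b = a + c"
    and "\<beta> > 0" "\<gamma> > 0" "\<alpha>' > 0" "\<beta>' > 0"
    and "hom_kernel (monomial_curve_hom a b c :: 'k::field poly3 \<Rightarrow> 'k poly) =
         ideal_generated (minors_2x3 (var_X, var_Y ^ \<beta>, var_Z ^ \<gamma>)
                                     (var_Y ^ \<beta>', var_Z, var_X ^ \<alpha>'))"
  shows "(pseudo_symmetric_semigroup H \<longleftrightarrow> \<beta> * \<gamma> = 1 \<or> \<alpha>' * \<beta>' = 1) \<and>
         (\<beta> * \<gamma> = 1 \<or> \<alpha>' * \<beta>' = 1 \<longleftrightarrow>
            real d = (real a + 1) / 2 \<or> real d = (real c + 1) / 2)"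
proof -
  note rel = kernel_relations[OF assms(10-14)]
  have "b \<noteq> 0"
  proof
    assume "b = 0"
    then show False using assms(3,9) by simp
  qed
  have d: "d = \<beta> + \<beta>'"
  proof -
    have "b * d = b * (\<beta> + \<beta>')" using rel(1) assms(9) by (simp add: mult.commute)
    then show ?thesis using \<open>b \<noteq> 0\<close> by simp
  qed
  interpret monomial_curve_semigroup H a b c d \<beta> \<gamma> \<alpha>' \<beta>'
  proof
    show "n \<in> H \<longleftrightarrow> (\<exists>u v w. n = a * u + b * v + c * w)" for n
      using assms(3,4) semigroup_generated_three by (simp add: minimally_generated_by_def)
    show "coprime a b" using assms(6) by (simp add: coprime_iff_gcd_eq_1)
    show "a > 0" using rel(2) \<open>b \<noteq> 0\<close> assms(13) by (cases a) auto
    show "c > 0" using rel(3) \<open>b \<noteq> 0\<close> assms(10) by (cases c) auto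
  qed (use assms d rel \<open>b \<noteq> 0\<close> in auto)
  \<comment> \<open>A semigroup without gaps has genus 0 and, by convention, Frobenius number -1, so
    it is symmetric. Hence \<open>H\<close> has a gap and \<open>Max (UNIV - H)\<close> is
    meaningful.\<close>
  have "H \<noteq> UNIV"
  proof
    assume UNIV: "H = UNIV"
    have "frobenius_number H = - 1"
      unfolding frobenius_number_def
    proof (rule Greatest_equality)
      fix z assume "z \<notin> int ` H"
      then show "z \<le> - 1" using UNIV zero_le_imp_eq_int[of z] by fastforce
    qed auto
    then show False using assms(5) UNIV by (simp add: symmetric_semigroup_def genus_def)
  qed
  then have "pseudo_symmetric_semigroup H \<longleftrightarrow> \<beta> * \<gamma> = 1 \<or> \<alpha>' * \<beta>' = 1"
    using pseudo_symmetric_iff_exponents assms(1) by blast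
  moreover have "real d = (real n + 1) / 2 \<longleftrightarrow> 2 * d = n + 1" for n by auto
  ultimately show ?thesis using exponents_iff_d by simp
qed

end
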